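(* Let $F$ be a tract, let $\varphi$ be a strong Wick function on $E=[n]\cup[n]^*$ with coefficients in $F$, and let $e\in E$. Then $\varphi|e$ is a strong Wick function with coefficients in $F$ (on $E\setminus\{e,e^*\}$), and $\underline{M}_{\varphi|e}=\underline{M}_\varphi|e$. The same holds for weak Wick functions and for moderately weak Wick functions.
   Context: A tract $F=(G,N_F)$ is an abelian group $G$ (written multiplicatively) with a subset $N_F$ of the group semiring $\mathbb{N}[G]$ such that: $0\in N_F$; $1\notin N_F$; there is a unique $\epsilon\in G$ with $1+\epsilon\in N_F$; and $g\in G$, $a\in N_F$ imply $ga\in N_F$. Write $F$ also for $G\cup\{0\}$ (with $0\cdot x=0$), $F^\times=G$, $-1:=\epsilon$; formal sums of elements of $F$ are regarded as elements of $\mathbb{N}[G]$. Let $S$ be a finite set of positive integers and $E_S=S\cup S^*$, where $S^*=\{s^*:s\in S\}$ is a disjoint copy, with involution $*$ exchanging $s$ and $s^*$; $E=E_{[n]}$ with $[n]=\{1,\dots,n\}$, and $E\setminus\{e,e^*\}=E_{S}$ for $S=[n]\setminus\{e,e^*\}$. A transversal of $E_S$ is an $|S|$-element subset $T\subseteq E_S$ with $T\cap T^*=\emptyset$; $\triangle$ is symmetric difference. An orthogonal matroid on $E_S$ is a pair $M=(E_S,\mathcal{B})$ with $\mathcal{B}$ a nonempty set of transversals (bases) such that for $B_1,B_2\in\mathcal{B}$ and every $\{x_1,x_1^*\}\subseteq B_1\triangle B_2$ there is $\{x_2,x_2^*\}\subseteq B_1\triangle B_2$ with $\{x_2,x_2^*\}\neq\{x_1,x_1^*\}$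 and $B_1\triangle\{x_1,x_1^*,x_2,x_2^*\}\in\mathcal{B}$. An element $e$ is singular in $M$ if no basis contains $e$, nonsingular otherwise (if $e$ is singular, $e^*$ is nonsingular). For $e$ nonsingular, $M|e$ is the orthogonal matroid on $E_S\setminus\{e,e^*\}$ with bases $\{B\setminus\{e\}:e\in B\in\mathcal{B}\}$; for $e$ singular, $M|e:=M|e^*$. Let $\varphi$ be a map from the transversals of $E_S$ to $F$. For transversals $T_1,T_2$ with $(T_1\triangle T_2)\cap S=\{x_1<\dots<x_m\}$, consider the relation $(\ast)\ \sum_{k=1}^m(-1)^k\varphi(T_1\triangle\{x_k,x_k^*\})\varphi(T_2\triangle\{x_k,x_k^*\})\in N_F$. - $\varphi$ is a strong Wick function if it is not identically zero and $(\ast)$ holds for all $T_1,T_2$ (its support is then the set of bases of an orthogonal matroid). - $\varphi$ is a moderately weak Wick function if its support $\{T:\varphi(T)\neq0\}$ is the set of bases of an orthogonal matroid and $(\ast)$ holds for all $T_1,T_2$ for which at most four of the products $\varphi(T_1\triangle\{x_k,x_k^*\})\varphi(T_2\triangle\{x_k,x_k^*\})$ are nonzero. - $\varphi$ is a weak Wick function if its support is the set of bases of an orthogonal matroid and $(\ast)$ holds for all $T_1,T_2$ with $m=4$. $\underline{M}_\varphi$ is the orthogonal matroid whose set of bases is the support of $\varphi$. For $e\in E$, $\varphi|e$ is the map from transversals of $E\setminus\{e,e^*\}$ to $F$ given by $(\varphi|e)(T)=\varphi(T\cup\{e\})$ if $e$ is nonsingular in $\underline{M}_\varphi$, and $(\varphi|e)(T)=\varphi(T\cup\{e^*\})$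 otherwise. *)

theory Defs
  imports "HOL-Algebra.Group" "HOL-Library.Multiset" "HOL-Library.FuncSet"
begin

section \<open>Tracts\<close>

text \<open>
  An element of the group semiring \<open>\<nat>[G]\<close> is a finite formal sum of elements of \<open>G\<close> with
  natural number coefficients; it is represented by the multiset of its summands.  Thus
  \<open>{#}\<close> is \<open>0\<close>, \<open>{#g#}\<close> is \<open>g\<close>, the sum is multiset union, and multiplication by
  \<open>g \<in> G\<close> is the image under \<open>h \<mapsto> g \<otimes> h\<close>.
\<close>

definition group_semiring :: "('g, 'm) monoid_scheme \<Rightarrow> 'g multiset set" where
  "group_semiring G = {a. set_mset a \<subseteq> carrier G}"

locale tract = comm_group G for G (structure) +
  fixes N :: "'a multiset set"
  assumes null_subset: "N \<subseteq> group_semiring G"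
    and zero_null: "{#} \<in> N"
    and one_not_null: "{#\<one>#} \<notin> N"
    and ex1_eps: "\<exists>!\<epsilon>. \<epsilon> \<in> carrier G \<and> {#\<one>, \<epsilon>#} \<in> N"
    and scale_null: "\<lbrakk>g \<in> carrier G; a \<in> N\<rbrakk> \<Longrightarrow> image_mset (\<lambda>h. g \<otimes> h) a \<in> N"

text \<open>The set \<open>F = G \<union> {0}\<close> is encoded in the option type, with \<^const>\<open>None\<close> as \<open>0\<close>.\<close>

definition tract_carrier :: "('g, 'm) monoid_scheme \<Rightarrow> 'g option set" where
  "tract_carrier G = insert None (Some ` carrier G)"

definition tract_mult :: "('g, 'm) monoid_scheme \<Rightarrow> 'g option \<Rightarrow> 'g option \<Rightarrow> 'g option" where
  "tract_mult G a b =
     (case (a, b) of (Some x, Some y) \<Rightarrow> Some (x \<otimes>\<^bsub>G\<^esub> y) | _ \<Rightarrow> None)"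

definition tract_eps :: "('g, 'm) monoid_scheme \<Rightarrow> 'g multiset set \<Rightarrow> 'g" where
  "tract_eps G N = (THE \<epsilon>. \<epsilon> \<in> carrier G \<and> {#\<one>\<^bsub>G\<^esub>, \<epsilon>#} \<in> N)"

definition minus_one_power ::
    "('g, 'm) monoid_scheme \<Rightarrow> 'g multiset set \<Rightarrow> nat \<Rightarrow> 'g option" where
  "minus_one_power G N k = Some (tract_eps G N [^]\<^bsub>G\<^esub> k)"

definition formal :: "'g option \<Rightarrow> 'g multiset" where
  "formal a = (case a of None \<Rightarrow> {#} | Some g \<Rightarrow> {#g#})"

section \<open>Orthogonal matroids\<close>

text \<open>
  The set \<open>E\<^sub>S = S \<union> S\<^sup>*\<close> is the disjoint sum \<open>S <+> S\<close>: \<open>Inl s\<close> is the element \<open>s\<close> and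
  \<open>Inr s\<close> is \<open>s\<^sup>*\<close>.
\<close>

type_synonym elt = "nat + nat"

definition index_set :: "nat set \<Rightarrow> bool" where
  "index_set S \<longleftrightarrow> finite S \<and> (\<forall>s\<in>S. 0 < s)"

definition ground :: "nat set \<Rightarrow> elt set" where
  "ground S = S <+> S"

definition star :: "elt \<Rightarrow> elt" where
  "star e = (case e of Inl s \<Rightarrow> Inr s | Inr s \<Rightarrow> Inl s)"

definition transversals :: "nat set \<Rightarrow> elt set set" where
  "transversals S = {T. T \<subseteq> ground S \<and> card T = card S \<and> T \<inter> star ` T = {}}"

text \<open>A matroid is the pair of its ground set and its set of bases.\<close>

type_synonym matroid = "elt set \<times> elt set set"

definition orthogonal_matroid :: "nat set \<Rightarrow> matroid \<Rightarrow> bool" where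
  "orthogonal_matroid S M \<longleftrightarrow>
     index_set S \<and> fst M = ground S \<and> snd M \<subseteq> transversals S \<and> snd M \<noteq> {} \<and>
     (\<forall>B1\<in>snd M. \<forall>B2\<in>snd M. \<forall>x1. {x1, star x1} \<subseteq> sym_diff B1 B2 \<longrightarrow>
        (\<exists>x2. {x2, star x2} \<subseteq> sym_diff B1 B2 \<and> {x2, star x2} \<noteq> {x1, star x1} \<and>
              sym_diff B1 {x1, star x1, x2, star x2} \<in> snd M))"

definition singular :: "matroid \<Rightarrow> elt \<Rightarrow> bool" where
  "singular M e \<longleftrightarrow> (\<forall>B\<in>snd M. e \<notin> B)"

definition nonsingular_rep :: "matroid \<Rightarrow> elt \<Rightarrow> elt" where
  "nonsingular_rep M e = (if singular M e then star e else e)"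

text \<open>\<open>M|e\<close>\<close>

definition matroid_minor :: "matroid \<Rightarrow> elt \<Rightarrow> matroid" where
  "matroid_minor M e =
     (fst M - {e, star e},
      {B - {nonsingular_rep M e} | B. B \<in> snd M \<and> nonsingular_rep M e \<in> B})"

section \<open>Wick functions\<close>

text \<open>
  A map from the transversals of \<open>E\<^sub>S\<close> to \<open>F\<close> is represented by a total function whose values
  outside \<open>transversals S\<close> are irrelevant.
\<close>

type_synonym 'g wick_map = "elt set \<Rightarrow> 'g option"

definition diff_indices :: "nat set \<Rightarrow> elt set \<Rightarrow> elt set \<Rightarrow> nat set" where
  "diff_indices S T1 T2 = {s \<in> S. Inl s \<in> sym_diff T1 T2}"

text \<open>\<open>x\<^sub>k\<close>, for \<open>1 \<le> k \<le> m\<close>; list positions start at \<open>0\<close>.\<close>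

definition diff_index :: "nat set \<Rightarrow> elt set \<Rightarrow> elt set \<Rightarrow> nat \<Rightarrow> nat" where
  "diff_index S T1 T2 k = sorted_list_of_set (diff_indices S T1 T2) ! (k - 1)"

definition wick_product ::
    "('g, 'm) monoid_scheme \<Rightarrow> nat set \<Rightarrow> 'g wick_map \<Rightarrow> elt set \<Rightarrow> elt set \<Rightarrow> nat \<Rightarrow> 'g option"
  where
  "wick_product G S \<phi> T1 T2 k =
     (let x = Inl (diff_index S T1 T2 k) in
      tract_mult G (\<phi> (sym_diff T1 {x, star x})) (\<phi> (sym_diff T2 {x, star x})))"

definition wick_relation ::
    "('g, 'm) monoid_scheme \<Rightarrow> 'g multiset set \<Rightarrow> nat set \<Rightarrow> 'g wick_map \<Rightarrow> elt set \<Rightarrow> elt set \<Rightarrow> bool"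
  where
  "wick_relation G N S \<phi> T1 T2 \<longleftrightarrow>
     (\<Sum>k = 1..card (diff_indices S T1 T2).
        formal (tract_mult G (minus_one_power G N k) (wick_product G S \<phi> T1 T2 k))) \<in> N"

definition support :: "nat set \<Rightarrow> 'g wick_map \<Rightarrow> elt set set" where
  "support S \<phi> = {T \<in> transversals S. \<phi> T \<noteq> None}"

definition underlying_matroid :: "nat set \<Rightarrow> 'g wick_map \<Rightarrow> matroid" where
  "underlying_matroid S \<phi> = (ground S, support S \<phi>)"

definition strong_wick ::
    "('g, 'm) monoid_scheme \<Rightarrow> 'g multiset set \<Rightarrow> nat set \<Rightarrow> 'g wick_map \<Rightarrow> bool" where
  "strong_wick G N S \<phi> \<longleftrightarrow>
     index_set S \<and> \<phi> \<in> transversals S \<rightarrow> tract_carrier G \<and>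
     (\<exists>T\<in>transversals S. \<phi> T \<noteq> None) \<and>
     (\<forall>T1\<in>transversals S. \<forall>T2\<in>transversals S. wick_relation G N S \<phi> T1 T2)"

definition moderately_weak_wick ::
    "('g, 'm) monoid_scheme \<Rightarrow> 'g multiset set \<Rightarrow> nat set \<Rightarrow> 'g wick_map \<Rightarrow> bool" where
  "moderately_weak_wick G N S \<phi> \<longleftrightarrow>
     index_set S \<and> \<phi> \<in> transversals S \<rightarrow> tract_carrier G \<and>
     orthogonal_matroid S (underlying_matroid S \<phi>) \<and>
     (\<forall>T1\<in>transversals S. \<forall>T2\<in>transversals S.
        card {k \<in> {1..card (diff_indices S T1 T2)}. wick_product G S \<phi> T1 T2 k \<noteq> None} \<le> 4 \<longrightarrow>
        wick_relation G N S \<phi> T1 T2)"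

definition weak_wick ::
    "('g, 'm) monoid_scheme \<Rightarrow> 'g multiset set \<Rightarrow> nat set \<Rightarrow> 'g wick_map \<Rightarrow> bool" where
  "weak_wick G N S \<phi> \<longleftrightarrow>
     index_set S \<and> \<phi> \<in> transversals S \<rightarrow> tract_carrier G \<and>
     orthogonal_matroid S (underlying_matroid S \<phi>) \<and>
     (\<forall>T1\<in>transversals S. \<forall>T2\<in>transversals S.
        card (diff_indices S T1 T2) = 4 \<longrightarrow> wick_relation G N S \<phi> T1 T2)"

text \<open>\<open>S \ {e, e\<^sup>*}\<close>, the index set of the ground set of \<open>\<phi>|e\<close>\<close>

definition remove_index :: "nat set \<Rightarrow> elt \<Rightarrow> nat set" where
  "remove_index S e = {s \<in> S. Inl s \<notin> {e, star e}}"

text \<open>\<open>\<phi>|e\<close>\<close>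

definition wick_minor :: "nat set \<Rightarrow> 'g wick_map \<Rightarrow> elt \<Rightarrow> 'g wick_map" where
  "wick_minor S \<phi> e T = \<phi> (T \<union> {nonsingular_rep (underlying_matroid S \<phi>) e})"

section \<open>The support of a strong Wick function\<close>

lemma transversals_iff:
  assumes "finite S"
  shows "T \<in> transversals S \<longleftrightarrow> T \<subseteq> ground S \<and> (\<forall>s\<in>S. (Inl s \<in> T) \<noteq> (Inr s \<in> T))"
proof -
  define f :: "elt \<Rightarrow> nat" where "f e = (case e of Inl s \<Rightarrow> s | Inr s \<Rightarrow> s)" for e
  have f: "f (Inl s) = s" "f (Inr s) = s" for s
    by (simp_all add: f_def)
  have disj: "T \<inter> star ` T = {} \<longleftrightarrow> (\<forall>s. \<not> (Inl s \<in> T \<and> Inr s \<in> T))"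
  proof
    assume d: "T \<inter> star ` T = {}"
    show "\<forall>s. \<not> (Inl s \<in> T \<and> Inr s \<in> T)"
    proof (intro allI notI)
      fix s assume a: "Inl s \<in> T \<and> Inr s \<in> T"
      have "star (Inr s) = Inl s"
        by (simp add: star_def)
      with a have "Inl s \<in> T \<inter> star ` T"
        by (metis IntI imageI)
      with d show False by simp
    qed
  qed (auto simp: star_def split: sum.splits)
  have inj: "inj_on f T" if "\<forall>s. \<not> (Inl s \<in> T \<and> Inr s \<in> T)"
    using that by (auto simp: inj_on_def f_def split: sum.splits)
  have im: "f ` T \<subseteq> S" if "T \<subseteq> ground S"
    using that by (auto simp: ground_def f)
  show ?thesis
  proof
    assume "T \<in> transversals S"
    then have T: "T \<subseteq> ground S" "card T = card S" "\<forall>s. \<not> (Inl s \<in> T \<and> Inr s \<in> T)"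
      using disj by (auto simp: transversals_def)
    have "f ` T = S"
      using card_subset_eq[OF assms im[OF T(1)]] card_image[OF inj[OF T(3)]] T(2) by simp
    then have "Inl s \<in> T \<or> Inr s \<in> T" if "s \<in> S" for s
      using that by (auto simp: f_def split: sum.splits)
    with T show "T \<subseteq> ground S \<and> (\<forall>s\<in>S. (Inl s \<in> T) \<noteq> (Inr s \<in> T))"
      by blast
  next
    assume a: "T \<subseteq> ground S \<and> (\<forall>s\<in>S. (Inl s \<in> T) \<noteq> (Inr s \<in> T))"
    then have nb: "\<forall>s. \<not> (Inl s \<in> T \<and> Inr s \<in> T)"
      by (auto simp: ground_def)
    have "s \<in> f ` T" if "s \<in> S" for s
      using a that f by (metis imageI)
    then have "f ` T = S"
      using im a by blast
    then show "T \<in> transversals S"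
      using a nb disj card_image[OF inj[OF nb]] by (auto simp: transversals_def)
  qed
qed

lemma transversal_flip:
  assumes "finite S" "T \<in> transversals S" "s \<in> S"
  shows "sym_diff T {Inl s, Inr s} \<in> transversals S"
  using assms by (auto simp: transversals_iff ground_def)

text \<open>The support of a strong Wick function is the set of bases of an orthogonal matroid.\<close>

lemma strong_wick_orthogonal_matroid:
  assumes "tract G N" and w: "strong_wick G N S \<phi>"
  shows "orthogonal_matroid S (underlying_matroid S \<phi>)"
proof -
  interpret tract G N by fact
  have idx: "index_set S" and fin: "finite S"
    using w by (auto simp: strong_wick_def index_set_def)
  have eps: "tract_eps G N \<in> carrier G"
    using theI'[OF ex1_eps] by (simp add: tract_eps_def)
  have val: "\<exists>g\<in>carrier G. \<phi> T = Some g" if "T \<in> support S \<phi>" for T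
    using w that by (auto simp: strong_wick_def support_def tract_carrier_def Pi_def)
  have single: "{#g#} \<notin> N" if "g \<in> carrier G" for g
    using scale_null[of "inv\<^bsub>G\<^esub> g" "{#g#}"] one_not_null that by auto
  have exch: "\<exists>x2. {x2, star x2} \<subseteq> sym_diff B1 B2 \<and> {x2, star x2} \<noteq> {x1, star x1} \<and>
              sym_diff B1 {x1, star x1, x2, star x2} \<in> support S \<phi>"
    if B: "B1 \<in> support S \<phi>" "B2 \<in> support S \<phi>"
      and x1: "{x1, star x1} \<subseteq> sym_diff B1 B2" for B1 B2 x1
  proof -
    obtain s where s: "{x1, star x1} = {Inl s, Inr s}"
      by (cases x1) (auto simp: star_def)
    have BT: "B1 \<in> transversals S" "B2 \<in> transversals S"
      using B by (auto simp: support_def)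
    have pm: "Inl s \<in> sym_diff B1 B2"
      using s x1 by auto
    then have sS: "s \<in> S"
      using BT by (auto simp: transversals_iff[OF fin] ground_def)
    define T1 where "T1 = sym_diff B1 {Inl s, Inr s}"
    define T2 where "T2 = sym_diff B2 {Inl s, Inr s}"
    have T: "T1 \<in> transversals S" "T2 \<in> transversals S"
      unfolding T1_def T2_def by (intro transversal_flip fin BT sS)+
    define D where "D = diff_indices S T1 T2"
    have finD: "finite D"
      using fin by (simp add: D_def diff_indices_def)
    have D_eq: "D = {t \<in> S. Inl t \<in> sym_diff B1 B2}"
      by (auto simp: D_def diff_indices_def T1_def T2_def)
    define h where "h k = sorted_list_of_set D ! (k - 1)" for k
    have bij: "bij_betw h {1..card D} D"
    proof -
      have "bij_betw (\<lambda>k. k - 1) {1..card D} {..<card D}"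
        by (rule bij_betw_byWitness[where f' = Suc]) auto
      moreover have "bij_betw ((!) (sorted_list_of_set D)) {..<card D} D"
        by (rule bij_betw_nth) (use finD in simp_all)
      ultimately have "bij_betw ((!) (sorted_list_of_set D) \<circ> (\<lambda>k. k - 1)) {1..card D} D"
        by (rule bij_betw_trans)
      then show ?thesis by (simp add: h_def comp_def cong: bij_betw_cong)
    qed
    have "s \<in> D"
      using pm sS D_eq by auto
    then have "s \<in> h ` {1..card D}"
      using bij by (simp add: bij_betw_def)
    then obtain k0 where k0: "k0 \<in> {1..card D}" "h k0 = s"
      by blast
    have wp: "wick_product G S \<phi> T1 T2 k =
        tract_mult G (\<phi> (sym_diff T1 {Inl (h k), Inr (h k)})) (\<phi> (sym_diff T2 {Inl (h k), Inr (h k)}))"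
      for k
      by (simp add: wick_product_def diff_index_def h_def D_def star_def Let_def)
    have restore: "sym_diff T1 {Inl s, Inr s} = B1" "sym_diff T2 {Inl s, Inr s} = B2"
      by (auto simp: T1_def T2_def)
    define trm where
      "trm k = formal (tract_mult G (minus_one_power G N k) (wick_product G S \<phi> T1 T2 k))" for k
    obtain g1 g2 where g: "\<phi> B1 = Some g1" "\<phi> B2 = Some g2" "g1 \<in> carrier G" "g2 \<in> carrier G"
      using val B by metis
    have t0: "trm k0 = {#(tract_eps G N [^]\<^bsub>G\<^esub> k0) \<otimes>\<^bsub>G\<^esub> (g1 \<otimes>\<^bsub>G\<^esub> g2)#}"
      unfolding trm_def wp k0(2) restore by (simp add: g tract_mult_def minus_one_power_def formal_def)
    have "(\<Sum>k = 1..card D. trm k) \<in> N"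
      using w T by (simp add: strong_wick_def wick_relation_def trm_def D_def)
    moreover have "(\<Sum>k = 1..card D. trm k) = trm k0 + (\<Sum>k \<in> {1..card D} - {k0}. trm k)"
      using k0(1) by (simp add: sum.remove)
    moreover have "trm k0 \<notin> N"
      unfolding t0 using eps g by (intro single) simp
    ultimately have nz_sum: "(\<Sum>k \<in> {1..card D} - {k0}. trm k) \<noteq> {#}"
      by auto
    have "\<exists>k\<in>{1..card D} - {k0}. trm k \<noteq> {#}"
    proof (rule ccontr)
      assume "\<not> ?thesis"
      then have "(\<Sum>k \<in> {1..card D} - {k0}. trm k) = {#}"
        by (intro sum.neutral) blast
      with nz_sum show False by contradiction
    qed
    then obtain k where k: "k \<in> {1..card D}" "k \<noteq> k0" "trm k \<noteq> {#}"
      by blast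
    define t where "t = h k"
    have tD: "t \<in> D"
      unfolding t_def using bij k(1) by (rule bij_betw_apply)
    have ts: "t \<noteq> s"
      using inj_onD[OF bij_betw_imp_inj_on[OF bij], of k k0] k k0 by (auto simp: t_def)
    have nz: "\<phi> (sym_diff T1 {Inl t, Inr t}) \<noteq> None"
      using k(3) unfolding trm_def wp
      by (auto simp: t_def tract_mult_def formal_def split: option.splits)
    have "sym_diff T1 {Inl t, Inr t} \<in> support S \<phi>"
      unfolding support_def using nz transversal_flip[OF fin T(1), of t] tD D_eq by auto
    moreover have "sym_diff B1 {Inl s, Inr s, Inl t, Inr t} = sym_diff T1 {Inl t, Inr t}"
      using ts by (auto simp: T1_def)
    moreover have "{x1, star x1, Inl t, star (Inl t)} = {Inl s, Inr s, Inl t, Inr t}"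
      using s by (auto simp: star_def)
    moreover have "{Inl t, star (Inl t)} \<subseteq> sym_diff B1 B2"
    proof -
      have "t \<in> S" "Inl t \<in> sym_diff B1 B2"
        using tD D_eq by auto
      moreover have "(Inl t \<in> B) \<noteq> (Inr t \<in> B)" if "B \<in> transversals S" for B
        using that \<open>t \<in> S\<close> transversals_iff[OF fin] by blast
      ultimately have "Inr t \<in> sym_diff B1 B2"
        using BT by blast
      with \<open>Inl t \<in> sym_diff B1 B2\<close> show ?thesis
        by (simp add: star_def)
    qed
    moreover have "{Inl t, star (Inl t)} \<noteq> {x1, star x1}"
      using ts s by (auto simp: star_def)
    ultimately show ?thesis
      by metis
  qed
  show ?thesis
    unfolding orthogonal_matroid_def underlying_matroid_def fst_conv snd_conv
    using idx exch w by (auto simp: support_def strong_wick_def)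
qed

end

theory Submission
  imports Defs
begin

text \<open>
  Write \<open>r\<close> for the nonsingular one among \<open>e\<close>, \<open>e\<^sup>*\<close>.  Then \<open>T \<mapsto> T \<union> {r}\<close> is a bijection from the
  transversals of the smaller ground set onto the transversals containing \<open>r\<close>.  It preserves
  symmetric differences, hence the indices \<open>x\<^sub>k\<close> and their order, so each Wick relation of \<open>\<phi>|e\<close>
  for \<open>T\<^sub>1, T\<^sub>2\<close> is literally the Wick relation of \<open>\<phi>\<close> for \<open>T\<^sub>1 \<union> {r}, T\<^sub>2 \<union> {r}\<close>.
\<close>

context
  fixes S :: "nat set" and i :: nat and r :: elt
  assumes fin: "finite S" and i: "i \<in> S" and r: "r = Inl i \<or> r = Inr i"
begin

text \<open>A transversal containing \<open>r\<close> omits \<open>star r\<close>, so removing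
  \<open>r\<close> leaves a set that avoids both elements over \<open>i\<close>; the choices at all
  other indices are untouched.\<close>

lemma insert_transversal_iff:
  "T \<in> transversals (S - {i}) \<longleftrightarrow> r \<notin> T \<and> insert r T \<in> transversals S"
proof -
  have fin': "finite (S - {i})"
    using fin by simp
  show ?thesis
    unfolding transversals_iff[OF fin] transversals_iff[OF fin']
    using i r by (auto simp: ground_def)
qed

text \<open>After the insertion both sets make the same choice at \<open>i\<close>, so
  \<open>i\<close> is not a difference index. Since the index sets agree, so do their enumerations,
  and every index keeps its sign.\<close>

lemma diff_indices_insert:
  assumes "T1 \<in> transversals (S - {i})" "T2 \<in> transversals (S - {i})"
  shows "diff_indices S (insert r T1) (insert r T2) = diff_indices (S - {i}) T1 T2"
  using assms r by (auto simp: diff_indices_def transversals_def ground_def)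

lemma diff_index_mem:
  assumes "k \<in> {1..card (diff_indices S T1 T2)}"
  shows "diff_index S T1 T2 k \<in> diff_indices S T1 T2"
proof -
  have "finite (diff_indices S T1 T2)"
    using fin by (simp add: diff_indices_def)
  then show ?thesis
    unfolding diff_index_def using assms
    by (metis One_nat_def Suc_le_lessD Suc_pred atLeastAtMost_iff less_eq_Suc_le
        length_sorted_list_of_set nth_mem set_sorted_list_of_set)
qed

context
  fixes \<phi> \<psi> :: "'g wick_map"
  assumes \<psi>: "\<psi> T = \<phi> (insert r T)"
begin

text \<open>The bound on \<open>k\<close> makes \<open>s\<close> a genuine difference index, hence
  \<open>s\<close> differs from \<open>i\<close>. Flipping the pair over \<open>s\<close> therefore
  commutes with inserting \<open>r\<close>.\<close>

lemma wick_product_insert: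
  assumes T: "T1 \<in> transversals (S - {i})" "T2 \<in> transversals (S - {i})"
    and k: "k \<in> {1..card (diff_indices (S - {i}) T1 T2)}"
  shows "wick_product G (S - {i}) \<psi> T1 T2 k = wick_product G S \<phi> (insert r T1) (insert r T2) k"
proof -
  define s where "s = diff_index (S - {i}) T1 T2 k"
  have s: "diff_index S (insert r T1) (insert r T2) k = s"
    by (simp add: s_def diff_index_def diff_indices_insert[OF T])
  have "s \<in> diff_indices (S - {i}) T1 T2"
    using diff_index_mem[of k "insert r T1" "insert r T2"] k
    by (simp add: s diff_indices_insert[OF T])
  then have "s \<noteq> i"
    by (simp add: diff_indices_def)
  then have "sym_diff (insert r T) {Inl s, Inr s} = insert r (sym_diff T {Inl s, Inr s})" for T
    using r by auto
  then show ?thesis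
    by (simp add: wick_product_def s flip: s_def) (simp add: \<psi> star_def)
qed

lemma wick_relation_insert:
  assumes T: "T1 \<in> transversals (S - {i})" "T2 \<in> transversals (S - {i})"
  shows "wick_relation G N (S - {i}) \<psi> T1 T2 \<longleftrightarrow> wick_relation G N S \<phi> (insert r T1) (insert r T2)"
  unfolding wick_relation_def diff_indices_insert[OF T]
  by (simp add: wick_product_insert[OF T])

lemma mem_support_iff:
  "T \<in> support (S - {i}) \<psi> \<longleftrightarrow> r \<notin> T \<and> insert r T \<in> support S \<phi>"
  by (auto simp: support_def insert_transversal_iff \<psi>)

text \<open>The right-hand side is the set of bases in \<open>matroid_minor\<close> when
  \<open>r\<close> is the nonsingular representative, so this yields the equality of underlying
  matroids.\<close>

lemma support_insert:
  "support (S - {i}) \<psi> = {B - {r} | B. B \<in> support S \<phi> \<and> r \<in> B}"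
proof (intro equalityI subsetI)
  fix T assume "T \<in> support (S - {i}) \<psi>"
  then have "insert r T \<in> support S \<phi>" "T = insert r T - {r}"
    by (auto simp: mem_support_iff)
  then show "T \<in> {B - {r} | B. B \<in> support S \<phi> \<and> r \<in> B}"
    by blast
qed (auto simp: mem_support_iff insert_absorb)

text \<open>Exchange is carried out between the bases enlarged by \<open>r\<close>. Their symmetric
  difference does not contain \<open>r\<close>, so the exchange keeps \<open>r\<close>, which can
  then be removed again. The basis through \<open>r\<close> ensures that some basis
  survives.\<close>

lemma orthogonal_matroid_insert:
  assumes om: "orthogonal_matroid S (underlying_matroid S \<phi>)"
    and ns: "\<exists>B\<in>support S \<phi>. r \<in> B"
  shows "orthogonal_matroid (S - {i}) (underlying_matroid (S - {i}) \<psi>)"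
proof -
  have "\<exists>x2. {x2, star x2} \<subseteq> sym_diff B1 B2 \<and> {x2, star x2} \<noteq> {x1, star x1} \<and>
             sym_diff B1 {x1, star x1, x2, star x2} \<in> support (S - {i}) \<psi>"
    if B: "B1 \<in> support (S - {i}) \<psi>" "B2 \<in> support (S - {i}) \<psi>"
      and x1: "{x1, star x1} \<subseteq> sym_diff B1 B2" for B1 B2 x1
  proof -
    have B': "insert r B1 \<in> support S \<phi>" "insert r B2 \<in> support S \<phi>"
      and r': "r \<notin> B1" "r \<notin> B2"
      using B by (auto simp: mem_support_iff)
    have sd: "sym_diff (insert r B1) (insert r B2) = sym_diff B1 B2"
      using r' by auto
    obtain x2 where x2: "{x2, star x2} \<subseteq> sym_diff B1 B2" "{x2, star x2} \<noteq> {x1, star x1}"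
      "sym_diff (insert r B1) {x1, star x1, x2, star x2} \<in> support S \<phi>"
      using om B' x1 unfolding orthogonal_matroid_def underlying_matroid_def fst_conv snd_conv
      by (metis sd)
    \<comment> \<open>Both pairs lie in \<open>sym_diff B1 B2\<close>, and neither \<open>B1\<close>
      nor \<open>B2\<close> contains \<open>r\<close>.\<close>
    have "r \<notin> {x1, star x1, x2, star x2}"
      using r' x1 x2(1) by blast
    then have "sym_diff (insert r B1) {x1, star x1, x2, star x2} =
        insert r (sym_diff B1 {x1, star x1, x2, star x2})"
      "r \<notin> sym_diff B1 {x1, star x1, x2, star x2}"
      using r' by auto
    then have "sym_diff B1 {x1, star x1, x2, star x2} \<in> support (S - {i}) \<psi>"
      using x2(3) by (simp only: mem_support_iff) simp
    with x2 show ?thesis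
      by blast
  qed
  moreover have "support (S - {i}) \<psi> \<noteq> {}"
    using ns support_insert by blast
  moreover have "index_set (S - {i})"
    using om by (simp add: orthogonal_matroid_def index_set_def)
  moreover have "support (S - {i}) \<psi> \<subseteq> transversals (S - {i})"
    by (auto simp: support_def)
  ultimately show ?thesis
    unfolding orthogonal_matroid_def underlying_matroid_def fst_conv snd_conv by blast
qed

lemma strong_wick_insert:
  assumes "strong_wick G N S \<phi>" and "\<exists>B\<in>support S \<phi>. r \<in> B"
  shows "strong_wick G N (S - {i}) \<psi>"
proof -
  have "support (S - {i}) \<psi> \<noteq> {}"
    using assms(2) support_insert by blast
  then have "\<exists>T\<in>transversals (S - {i}). \<psi> T \<noteq> None"
    by (auto simp: support_def)
  then show ?thesis
    using assms(1)
    by (auto simp: strong_wick_def index_set_def Pi_def \<psi> insert_transversal_iff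
        wick_relation_insert)
qed

lemma weak_wick_insert:
  assumes "weak_wick G N S \<phi>" and "\<exists>B\<in>support S \<phi>. r \<in> B"
  shows "weak_wick G N (S - {i}) \<psi>"
proof -
  have "orthogonal_matroid (S - {i}) (underlying_matroid (S - {i}) \<psi>)"
    using assms orthogonal_matroid_insert by (simp add: weak_wick_def)
  moreover have "wick_relation G N (S - {i}) \<psi> T1 T2"
    if T: "T1 \<in> transversals (S - {i})" "T2 \<in> transversals (S - {i})"
      and "card (diff_indices (S - {i}) T1 T2) = 4" for T1 T2
    using assms(1) that
    by (simp add: weak_wick_def wick_relation_insert[OF T] insert_transversal_iff
        flip: diff_indices_insert[OF T])
  ultimately show ?thesis
    using assms(1)
    by (auto simp: weak_wick_def index_set_def Pi_def \<psi> insert_transversal_iff)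
qed

lemma moderately_weak_wick_insert:
  assumes "moderately_weak_wick G N S \<phi>" and "\<exists>B\<in>support S \<phi>. r \<in> B"
  shows "moderately_weak_wick G N (S - {i}) \<psi>"
proof -
  have "orthogonal_matroid (S - {i}) (underlying_matroid (S - {i}) \<psi>)"
    using assms orthogonal_matroid_insert by (simp add: moderately_weak_wick_def)
  moreover have "wick_relation G N (S - {i}) \<psi> T1 T2"
    if T: "T1 \<in> transversals (S - {i})" "T2 \<in> transversals (S - {i})"
      and c: "card {k \<in> {1..card (diff_indices (S - {i}) T1 T2)}.
                    wick_product G (S - {i}) \<psi> T1 T2 k \<noteq> None} \<le> 4" for T1 T2
  proof -
    \<comment> \<open>The threshold four counts nonzero products, so besides the number of indices
      the individual products have to match.\<close>
    have "{k \<in> {1..card (diff_indices (S - {i}) T1 T2)}.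
            wick_product G (S - {i}) \<psi> T1 T2 k \<noteq> None} =
          {k \<in> {1..card (diff_indices S (insert r T1) (insert r T2))}.
            wick_product G S \<phi> (insert r T1) (insert r T2) k \<noteq> None}"
      unfolding diff_indices_insert[OF T]
      by (intro Collect_cong conj_cong refl) (simp add: wick_product_insert[OF T])
    then show ?thesis
      using assms(1) T c
      by (simp add: moderately_weak_wick_def wick_relation_insert[OF T] insert_transversal_iff)
  qed
  ultimately show ?thesis
    using assms(1)
    by (auto simp: moderately_weak_wick_def index_set_def Pi_def \<psi> insert_transversal_iff)
qed

end

end

theorem proposition3p25:
  fixes G :: "('g, 'm) monoid_scheme" and N :: "'g multiset set"
    and n :: nat and \<phi> :: "'g wick_map" and e :: elt
  assumes "tract G N" and "e \<in> ground {1..n}"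
  shows "(strong_wick G N {1..n} \<phi> \<longrightarrow>
            strong_wick G N (remove_index {1..n} e) (wick_minor {1..n} \<phi> e) \<and>
            underlying_matroid (remove_index {1..n} e) (wick_minor {1..n} \<phi> e) =
              matroid_minor (underlying_matroid {1..n} \<phi>) e)
       \<and> (weak_wick G N {1..n} \<phi> \<longrightarrow>
            weak_wick G N (remove_index {1..n} e) (wick_minor {1..n} \<phi> e) \<and>
            underlying_matroid (remove_index {1..n} e) (wick_minor {1..n} \<phi> e) =
              matroid_minor (underlying_matroid {1..n} \<phi>) e)
       \<and> (moderately_weak_wick G N {1..n} \<phi> \<longrightarrow>
            moderately_weak_wick G N (remove_index {1..n} e) (wick_minor {1..n} \<phi> e) \<and>
            underlying_matroid (remove_index {1..n} e) (wick_minor {1..n} \<phi> e) =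
              matroid_minor (underlying_matroid {1..n} \<phi>) e)"
proof -
  define S where "S = {1..n}"
  define M where "M = underlying_matroid S \<phi>"
  define r where "r = nonsingular_rep M e"
  obtain i where i: "i \<in> S" "e = Inl i \<or> e = Inr i"
    using assms(2) by (auto simp: ground_def S_def)
  have fin: "finite S"
    by (simp add: S_def)
  have star: "{e, star e} = {Inl i, Inr i}"
    using i by (auto simp: star_def)
  then have r: "r = Inl i \<or> r = Inr i"
    by (auto simp: r_def nonsingular_rep_def)
  have S': "remove_index S e = S - {i}"
    unfolding remove_index_def star by auto
  \<comment> \<open>This is the hypothesis on \<open>\<psi>\<close> in the lemmas above, with
    \<open>wick_minor S \<phi> e\<close> for \<open>\<psi>\<close>.\<close>
  have minor: "wick_minor S \<phi> e T = \<phi> (insert r T)" for T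
    by (simp add: wick_minor_def r_def M_def)
  have ns: "\<exists>B\<in>support S \<phi>. r \<in> B" if om: "orthogonal_matroid S (underlying_matroid S \<phi>)"
  proof (cases "singular M e")
    case True
    obtain B where B: "B \<in> support S \<phi>"
      using om by (auto simp: orthogonal_matroid_def underlying_matroid_def)
    \<comment> \<open>Every transversal meets the pair over \<open>i\<close>; as \<open>e\<close> is
      singular, \<open>B\<close> must contain \<open>star e\<close>, which is \<open>r\<close>
      here.\<close>
    then have "e \<in> B \<or> star e \<in> B"
      using i star by (auto simp: support_def transversals_iff[OF fin] star_def)
    with True B show ?thesis
      by (auto simp: r_def nonsingular_rep_def singular_def M_def underlying_matroid_def)
  next
    case False
    then show ?thesis
      by (auto simp: r_def nonsingular_rep_def singular_def M_def underlying_matroid_def)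
  qed
  have "ground (S - {i}) = ground S - {e, star e}"
    unfolding star by (auto simp: ground_def)
  \<comment> \<open>Only the support of \<open>\<phi>\<close> enters, so one proof serves all three
    kinds of Wick function.\<close>
  then have matroid: "underlying_matroid (S - {i}) (wick_minor S \<phi> e) = matroid_minor M e"
    using support_insert[where \<phi> = \<phi> and \<psi> = "wick_minor S \<phi> e", OF fin i(1) r minor]
    by (simp add: underlying_matroid_def matroid_minor_def M_def r_def)
  show ?thesis
    unfolding S_def[symmetric] S' M_def[symmetric] matroid
  proof (intro conjI impI refl)
    \<comment> \<open>Here the orthogonal matroid comes from the tract axioms and the Wick
      relations; in the two weak cases it is part of the definition.\<close>
    assume "strong_wick G N S \<phi>"
    then show "strong_wick G N (S - {i}) (wick_minor S \<phi> e)"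
      using ns[OF strong_wick_orthogonal_matroid[OF assms(1)]]
      by (intro strong_wick_insert[where \<phi> = \<phi> and \<psi> = "wick_minor S \<phi> e",
            OF fin i(1) r minor])
  next
    assume "weak_wick G N S \<phi>"
    then show "weak_wick G N (S - {i}) (wick_minor S \<phi> e)"
      using ns
      by (intro weak_wick_insert[where \<phi> = \<phi> and \<psi> = "wick_minor S \<phi> e",
            OF fin i(1) r minor])
        (simp_all add: weak_wick_def)
  next
    assume "moderately_weak_wick G N S \<phi>"
    then show "moderately_weak_wick G N (S - {i}) (wick_minor S \<phi> e)"
      using ns
      by (intro moderately_weak_wick_insert[where \<phi> = \<phi> and \<psi> = "wick_minor S \<phi> e",
            OF fin i(1) r minor])
        (simp_all add: moderately_weak_wick_def)
  qed
qed

end
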